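(* Suppose that $(A,B)$ is stabilizable and $(A,C)$ is observable, where $Q=C^\top C$. Let $\bar P$ be the unique symmetric positive definite solution of the discrete algebraic Riccati equation $$\bar P=Q+\alpha A^\top\bar PA-\alpha^2A^\top\bar PB(R+\alpha B^\top\bar PB)^{-1}B^\top\bar PA,$$ and let $\bar K:=-\alpha(R+\alpha B^\top\bar PB)^{-1}B^\top\bar PA$. Then, for each $\boldsymbol{x}\in\mathbb{R}^n$, $$\pi'_\lambda(\boldsymbol{x})\to\bar K\boldsymbol{x}\quad\text{and}\quad w'^{(i)}_{\lambda,\boldsymbol{x}}\to\hat w^{(i)}\ \ (i=1,\ldots,N)\qquad\text{as }\lambda\to\infty,$$ where $\pi'_\lambda$ and $w'^{(i)}_{\lambda,\boldsymbol{x}}$ are the policy and the worst-case support points of the Wasserstein-penalized linear-quadratic problem with penalty parameter $\lambda$, as defined in the context.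
   Context: Setting. $A\in\mathbb{R}^{n\times n}$, $B\in\mathbb{R}^{n\times m}$, $\Xi\in\mathbb{R}^{n\times l}$; $Q=Q^\top\in\mathbb{R}^{n\times n}$ is positive semidefinite, $R=R^\top\in\mathbb{R}^{m\times m}$ is positive definite; $\alpha\in(0,1)$ is a discount factor; $\hat w^{(1)},\ldots,\hat w^{(N)}\in\mathbb{R}^l$ are data samples with $\frac1N\sum_i\hat w^{(i)}=0$. (These are the data of the system $x_{t+1}=Ax_t+Bu_t+\Xi w_t$ with stage cost $x^\top Qx+u^\top Ru$ and Wasserstein penalty $\lambda W_2(\mu_t,\nu_N)^2$, $\nu_N=\frac1N\sum_i\delta_{\hat w^{(i)}}$.) For each sufficiently large penalty parameter $\lambda$ (say $\lambda\ge\bar\lambda$), let $P=P_\lambda\in\mathbb{R}^{n\times n}$ be a symmetric positive semidefinite solution, with $\lambda I-\alpha\Xi^\top P\Xi$ positive definite, of $$P=Q+\alpha A^\top PA+\alpha^2A^\top SA,$$ $$\begin{aligned}S:={}&P\Xi(\lambda I-\alpha\Xi^\top P\Xi)^{-1}\Xi^\top P\\&-[I+\alpha\Xi(\lambda I-\alpha\Xi^\top P\Xi)^{-1}\Xi^\top P]^\top PB\\&\quad\times[R+\alpha B^\top\{P+\alpha P\Xi(\lambda I-\alpha\Xi^\top P\Xi)^{-1}\Xi^\top P\}B]^{-1}\\&\quad\times B^\top P[I+\alpha\Xi(\lambda I-\alpha\Xi^\top P\Xi)^{-1}\Xi^\top P].\end{aligned}$$ With $P=P_\lambda$, define $$\begin{aligned}K_\lambda:={}&-[R+\alpha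 B^\top\{P+\alpha P\Xi(\lambda I-\alpha\Xi^\top P\Xi)^{-1}\Xi^\top P\}B]^{-1}\\&\times\alpha B^\top P^\top[I+\alpha\Xi(\lambda I-\alpha\Xi^\top P\Xi)^{-1}\Xi^\top P]A,\end{aligned}$$ $\pi'_\lambda(\boldsymbol{x}):=K_\lambda\boldsymbol{x}$, and $w'^{(i)}_{\lambda,\boldsymbol{x}}:=(\lambda I-\alpha\Xi^\top P\Xi)^{-1}[\alpha\Xi^\top P(A+BK_\lambda)\boldsymbol{x}+\lambda\hat w^{(i)}]$.
   Formalization: For every large λ, P_λ is taken to be the least (in the Loewner order) admissible symmetric positive semidefinite solution of the penalized Riccati equation; for an arbitrary choice of solution the limits can fail, since some solutions grow linearly in λ. *)

theory Defs
  imports "HOL-Analysis.Analysis"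
begin

definition pos_semidef :: "real^'k^'k \<Rightarrow> bool" where
  "pos_semidef M \<longleftrightarrow> transpose M = M \<and> (\<forall>x. 0 \<le> x \<bullet> (M *v x))"

definition pos_def :: "real^'k^'k \<Rightarrow> bool" where
  "pos_def M \<longleftrightarrow> transpose M = M \<and> (\<forall>x. x \<noteq> 0 \<longrightarrow> 0 < x \<bullet> (M *v x))"

text \<open>Discrete time: all complex eigenvalues lie in the open unit disc.\<close>

definition schur_stable :: "real^'n^'n \<Rightarrow> bool" where
  "schur_stable M \<longleftrightarrow>
     (\<forall>z v. v \<noteq> 0 \<and> map_matrix complex_of_real M *v v = z *s v \<longrightarrow> norm z < 1)"

definition stabilizable :: "real^'n^'n \<Rightarrow> real^'m^'n \<Rightarrow> bool" where
  "stabilizable A B \<longleftrightarrow> (\<exists>K :: real^'n^'m. schur_stable (A + B ** K))"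

text \<open>The output sequence \<open>y\<^sub>t = C A\<^sup>t x\<close> determines the initial state \<open>x\<close>.\<close>

definition observable :: "real^'n^'n \<Rightarrow> real^'n^'p \<Rightarrow> bool" where
  "observable A C \<longleftrightarrow>
     (\<forall>x y. (\<forall>t::nat. C *v (((*v) A ^^ t) x) = C *v (((*v) A ^^ t) y)) \<longrightarrow> x = y)"

definition dare_solution ::
  "real^'n^'n \<Rightarrow> real^'m^'n \<Rightarrow> real^'n^'n \<Rightarrow> real^'m^'m \<Rightarrow> real \<Rightarrow> real^'n^'n \<Rightarrow> bool" where
  "dare_solution A B Q R \<alpha> P \<longleftrightarrow>
     P = Q + \<alpha> *\<^sub>R (transpose A ** P ** A)
         - \<alpha>\<^sup>2 *\<^sub>R (transpose A ** P ** B
              ** matrix_inv (R + \<alpha> *\<^sub>R (transpose B ** P ** B))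
              ** transpose B ** P ** A)"

definition dare_gain ::
  "real^'n^'n \<Rightarrow> real^'m^'n \<Rightarrow> real^'m^'m \<Rightarrow> real \<Rightarrow> real^'n^'n \<Rightarrow> real^'n^'m" where
  "dare_gain A B R \<alpha> P =
     - (\<alpha> *\<^sub>R (matrix_inv (R + \<alpha> *\<^sub>R (transpose B ** P ** B)) ** transpose B ** P ** A))"

definition pen_mat :: "real^'l^'n \<Rightarrow> real \<Rightarrow> real \<Rightarrow> real^'n^'n \<Rightarrow> real^'l^'l" where
  "pen_mat \<Xi> \<alpha> lam P = lam *\<^sub>R mat 1 - \<alpha> *\<^sub>R (transpose \<Xi> ** P ** \<Xi>)"

definition amp_mat :: "real^'l^'n \<Rightarrow> real \<Rightarrow> real \<Rightarrow> real^'n^'n \<Rightarrow> real^'n^'n" where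
  "amp_mat \<Xi> \<alpha> lam P =
     mat 1 + \<alpha> *\<^sub>R (\<Xi> ** matrix_inv (pen_mat \<Xi> \<alpha> lam P) ** transpose \<Xi> ** P)"

definition ctrl_mat ::
  "real^'m^'n \<Rightarrow> real^'l^'n \<Rightarrow> real^'m^'m \<Rightarrow> real \<Rightarrow> real \<Rightarrow> real^'n^'n \<Rightarrow> real^'m^'m" where
  "ctrl_mat B \<Xi> R \<alpha> lam P =
     R + \<alpha> *\<^sub>R (transpose B
           ** (P + \<alpha> *\<^sub>R (P ** \<Xi> ** matrix_inv (pen_mat \<Xi> \<alpha> lam P) ** transpose \<Xi> ** P))
           ** B)"

definition S_mat ::
  "real^'m^'n \<Rightarrow> real^'l^'n \<Rightarrow> real^'m^'m \<Rightarrow> real \<Rightarrow> real \<Rightarrow> real^'n^'n \<Rightarrow> real^'n^'n" where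
  "S_mat B \<Xi> R \<alpha> lam P =
     P ** \<Xi> ** matrix_inv (pen_mat \<Xi> \<alpha> lam P) ** transpose \<Xi> ** P
     - transpose (amp_mat \<Xi> \<alpha> lam P) ** P ** B
         ** matrix_inv (ctrl_mat B \<Xi> R \<alpha> lam P)
         ** transpose B ** P ** amp_mat \<Xi> \<alpha> lam P"

definition pen_riccati_solution ::
  "real^'n^'n \<Rightarrow> real^'m^'n \<Rightarrow> real^'l^'n \<Rightarrow> real^'n^'n \<Rightarrow> real^'m^'m \<Rightarrow> real \<Rightarrow> real
    \<Rightarrow> real^'n^'n \<Rightarrow> bool" where
  "pen_riccati_solution A B \<Xi> Q R \<alpha> lam P \<longleftrightarrow>
     pos_semidef P \<and> pos_def (pen_mat \<Xi> \<alpha> lam P) \<and>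
     P = Q + \<alpha> *\<^sub>R (transpose A ** P ** A)
         + \<alpha>\<^sup>2 *\<^sub>R (transpose A ** S_mat B \<Xi> R \<alpha> lam P ** A)"

text \<open>
  For a fixed penalty parameter the equation may have several admissible solutions. The one
  describing the optimal value, and hence the actual worst case, is the least in the Loewner
  order. Other solutions need not stay bounded: with scalar data, \<open>B = 0\<close>, \<open>\<Xi> = Q = R = 1\<close>,
  \<open>\<alpha> = A = 1/2\<close>, there is one that grows like \<open>7/4\<close> times the penalty parameter.
\<close>

definition least_pen_riccati_solution ::
  "real^'n^'n \<Rightarrow> real^'m^'n \<Rightarrow> real^'l^'n \<Rightarrow> real^'n^'n \<Rightarrow> real^'m^'m \<Rightarrow> real \<Rightarrow> real
    \<Rightarrow> real^'n^'n \<Rightarrow> bool" where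
  "least_pen_riccati_solution A B \<Xi> Q R \<alpha> lam P \<longleftrightarrow>
     pen_riccati_solution A B \<Xi> Q R \<alpha> lam P \<and>
     (\<forall>X. pen_riccati_solution A B \<Xi> Q R \<alpha> lam X \<longrightarrow> pos_semidef (X - P))"

definition pen_gain ::
  "real^'n^'n \<Rightarrow> real^'m^'n \<Rightarrow> real^'l^'n \<Rightarrow> real^'m^'m \<Rightarrow> real \<Rightarrow> real
    \<Rightarrow> real^'n^'n \<Rightarrow> real^'n^'m" where
  "pen_gain A B \<Xi> R \<alpha> lam P =
     - (matrix_inv (ctrl_mat B \<Xi> R \<alpha> lam P)
          ** (\<alpha> *\<^sub>R (transpose B ** transpose P ** amp_mat \<Xi> \<alpha> lam P ** A)))"

definition pen_policy ::
  "real^'n^'n \<Rightarrow> real^'m^'n \<Rightarrow> real^'l^'n \<Rightarrow> real^'m^'m \<Rightarrow> real \<Rightarrow> real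
    \<Rightarrow> real^'n^'n \<Rightarrow> real^'n \<Rightarrow> real^'m" where
  "pen_policy A B \<Xi> R \<alpha> lam P x = pen_gain A B \<Xi> R \<alpha> lam P *v x"

definition worst_case_point ::
  "real^'n^'n \<Rightarrow> real^'m^'n \<Rightarrow> real^'l^'n \<Rightarrow> real^'m^'m \<Rightarrow> real \<Rightarrow> real
    \<Rightarrow> real^'n^'n \<Rightarrow> real^'n \<Rightarrow> real^'l \<Rightarrow> real^'l" where
  "worst_case_point A B \<Xi> R \<alpha> lam P x w =
     matrix_inv (pen_mat \<Xi> \<alpha> lam P)
       *v (\<alpha> *\<^sub>R ((transpose \<Xi> ** P ** (A + B ** pen_gain A B \<Xi> R \<alpha> lam P)) *v x)
           + lam *\<^sub>R w)"

end

theory Submission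
  imports Defs
begin

text \<open>
  The penalized equation is the ordinary Riccati fixed point equation \<open>P = F(G\<^sub>\<lambda>(P))\<close>, where the
  Riccati map \<open>F\<close> is a minimum over the control and \<open>G\<^sub>\<lambda>\<close> a maximum over the disturbance. Hence
  both are monotone in the Loewner order, and \<open>G\<^sub>\<lambda>\<close> decreases in \<open>\<lambda>\<close>. So \<open>P\<^sub>\<lambda>\<close> is a supersolution
  for every larger penalty; iterating from 0 gives a solution below it, and by minimality \<open>P\<^sub>\<lambda>\<close>
  decreases in \<open>\<lambda>\<close>. Being bounded below by 0 it converges, and as \<open>G\<^sub>\<lambda>\<close> tends to the identity
  the limit solves the Riccati equation. Observability makes this limit positive definite, and
  makes positive definite solutions unique. The gains and support points converge by continuity.
\<close>

section \<open>Quadratic forms, the Loewner order and matrix inverses\<close>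

abbreviation qform :: "real^'k^'k \<Rightarrow> real^'k \<Rightarrow> real" where
  "qform M x \<equiv> x \<bullet> (M *v x)"

text \<open>Turns products of matrices into nested actions on a vector, so that matrix identities
  become linear algebra on vectors. Uses of it often delete \<open>transpose_matrix_vector\<close>,
  which would rewrite a transposed action into a row-vector product.\<close>

lemmas matrix_vector_push =
  matrix_vector_mul_assoc[symmetric] matrix_vector_mult_add_rdistrib
  matrix_vector_mult_diff_rdistrib scaleR_matrix_vector_assoc[symmetric]
  matrix_vector_right_distrib matrix_vector_mult_diff_distrib matrix_vector_mult_scaleR

lemma transpose_add: "transpose (M + N) = transpose M + transpose N"
  by (simp add: transpose_def vec_eq_iff)

lemma transpose_diff: "transpose (M - N) = transpose M - transpose N"
  for M N :: "real^'a^'b"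
  by (simp add: transpose_def vec_eq_iff)

lemma inner_matrix_vector_left: "(M *v x) \<bullet> y = x \<bullet> (transpose M *v y)"
  for M :: "real^'a^'b"
  by (metis dot_lmul_matrix inner_commute transpose_matrix_vector)

lemma inner_transpose_vector: "x \<bullet> (transpose M *v y) = (M *v x) \<bullet> y"
  for M :: "real^'a^'b"
  by (simp only: inner_matrix_vector_left)

lemma matrix_vector_uminus: "(- M) *v x = - (M *v x)"
  for M :: "real^'a^'b"
  using matrix_vector_mult_diff_rdistrib[of 0 M x] by simp

text \<open>Makes the Loewner order a pointwise comparison of quadratic forms, the shape in which
  minima and maxima can be compared. Symmetry is a separate premise because
  \<open>pos_semidef\<close> includes it and quadratic forms do not see it.\<close>

lemma pos_semidef_diff_iff:
  assumes "transpose X = X" "transpose Y = Y"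
  shows "pos_semidef (Y - X) \<longleftrightarrow> (\<forall>x. qform X x \<le> qform Y x)"
  using assms by (simp add: pos_semidef_def transpose_diff matrix_vector_push inner_diff_right)

lemma pos_semidef_refl: "pos_semidef (X - X)"
  by (simp add: pos_semidef_def transpose_def vec_eq_iff)

lemma pos_semidef_add:
  assumes "pos_semidef M" "pos_semidef N"
  shows "pos_semidef (M + N)"
  using assms by (simp add: pos_semidef_def transpose_add matrix_vector_mult_add_rdistrib inner_add_right)

lemma pos_semidef_trans:
  assumes "pos_semidef (Y - X)" "pos_semidef (Z - Y)"
  shows "pos_semidef (Z - X)"
  using pos_semidef_add[OF assms] by simp

lemma pos_semidef_transpose: "pos_semidef M \<Longrightarrow> transpose M = M"
  by (simp add: pos_semidef_def)

lemma pos_def_transpose: "pos_def M \<Longrightarrow> transpose M = M"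
  by (simp add: pos_def_def)

lemma pos_def_imp_semidef: "pos_def M \<Longrightarrow> pos_semidef M"
  unfolding pos_def_def pos_semidef_def
  by (metis inner_zero_left less_eq_real_def)

lemma matrix_inv_inverse:
  fixes M :: "real^'k^'k"
  assumes "invertible M"
  shows "M ** matrix_inv M = mat 1" "matrix_inv M ** M = mat 1"
proof -
  have "M ** matrix_inv M = mat 1 \<and> matrix_inv M ** M = mat 1"
    unfolding matrix_inv_def
    by (rule someI_ex) (use assms in \<open>simp add: invertible_def\<close>)
  then show "M ** matrix_inv M = mat 1" "matrix_inv M ** M = mat 1" by auto
qed

lemma matrix_inv_eqI:
  fixes M N :: "real^'k^'k"
  assumes "M ** N = mat 1"
  shows "matrix_inv M = N"
proof -
  have "invertible M"
    using assms invertible_right_inverse by blast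
  then have "matrix_inv M = matrix_inv M ** (M ** N)"
    by (simp add: assms)
  also have "\<dots> = N"
    by (simp add: matrix_mul_assoc matrix_inv_inverse(2) \<open>invertible M\<close>)
  finally show ?thesis .
qed

lemma pos_def_invertible:
  fixes M :: "real^'k^'k"
  assumes "pos_def M"
  shows "invertible M"
proof -
  have "x = 0" if "M *v x = 0" for x
    using assms that unfolding pos_def_def by fastforce
  then show ?thesis
    by (simp add: invertible_left_inverse matrix_left_invertible_ker)
qed

lemma transpose_matrix_inv:
  fixes M :: "real^'k^'k"
  assumes "pos_def M"
  shows "transpose (matrix_inv M) = matrix_inv M"
proof (rule sym, rule matrix_inv_eqI)
  have "transpose (matrix_inv M ** M) = mat 1"
    by (simp add: assms matrix_inv_inverse pos_def_invertible)
  then show "M ** transpose (matrix_inv M) = mat 1"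
    by (simp add: matrix_transpose_mul pos_def_transpose[OF assms])
qed

lemma matrix_inv_vector:
  fixes M :: "real^'k^'k"
  assumes "pos_def M"
  shows "M *v (matrix_inv M *v x) = x" "matrix_inv M *v (M *v x) = x"
  using matrix_inv_inverse[OF pos_def_invertible[OF assms]]
  by (simp_all add: matrix_vector_mul_assoc)

section \<open>Completing the square: extrema of quadratic functions\<close>

lemma complete_square:
  fixes M :: "real^'k^'k"
  assumes "pos_def M"
  shows "qform M u + 2 * (u \<bullet> b) = qform M (u + matrix_inv M *v b) - b \<bullet> (matrix_inv M *v b)"
proof -
  have "u \<bullet> b = (M *v u) \<bullet> (matrix_inv M *v b)"
    using assms by (simp add: inner_matrix_vector_left pos_def_transpose matrix_inv_vector)
  then show ?thesis
    using assms
    by (simp add: matrix_vector_push inner_add_left inner_add_right matrix_inv_vector inner_commute)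
qed

text \<open>The completed square is nonnegative and vanishes exactly at
  \<open>- (matrix_inv M *v b)\<close>. The first part bounds every competitor, the second evaluates
  the minimizer; this pair drives the minimization over controls.\<close>

lemma quadratic_lower_bound:
  fixes M :: "real^'k^'k"
  assumes "pos_def M"
  shows "- (b \<bullet> (matrix_inv M *v b)) \<le> qform M u + 2 * (u \<bullet> b)"
    and "qform M (- (matrix_inv M *v b)) + 2 * ((- (matrix_inv M *v b)) \<bullet> b)
      = - (b \<bullet> (matrix_inv M *v b))"
  using pos_def_imp_semidef[OF assms] unfolding complete_square[OF assms]
  by (simp_all add: pos_semidef_def)

text \<open>The same fact after the substitution of \<open>-u\<close> for \<open>u\<close>, in the
  form needed for the maximization over disturbances.\<close>

lemma quadratic_upper_bound:
  fixes M :: "real^'k^'k"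
  assumes "pos_def M"
  shows "2 * (u \<bullet> b) - qform M u \<le> b \<bullet> (matrix_inv M *v b)"
    and "2 * ((matrix_inv M *v b) \<bullet> b) - qform M (matrix_inv M *v b)
      = b \<bullet> (matrix_inv M *v b)"
  using quadratic_lower_bound(1)[OF assms, of b "-u"]
  by (simp_all add: matrix_vector_mult_scaleR[of _ "-1", simplified] matrix_inv_vector assms inner_commute)

subsection \<open>The Riccati map\<close>

text \<open>The map \<open>F\<close> of the overview. Separating it from the equation lets it be
  evaluated at matrices that are not solutions.\<close>

definition dare_map ::
  "real^'n^'n \<Rightarrow> real^'m^'n \<Rightarrow> real^'n^'n \<Rightarrow> real^'m^'m \<Rightarrow> real \<Rightarrow> real^'n^'n \<Rightarrow> real^'n^'n" where
  "dare_map A B Q R \<alpha> X =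
     Q + \<alpha> *\<^sub>R (transpose A ** X ** A)
       - \<alpha>\<^sup>2 *\<^sub>R (transpose A ** X ** B
            ** matrix_inv (R + \<alpha> *\<^sub>R (transpose B ** X ** B))
            ** transpose B ** X ** A)"

lemma dare_solution_iff: "dare_solution A B Q R \<alpha> X \<longleftrightarrow> X = dare_map A B Q R \<alpha> X"
  by (simp add: dare_solution_def dare_map_def)

lemma pos_def_control:
  assumes "pos_def R" "0 < \<alpha>" "pos_semidef X"
  shows "pos_def (R + \<alpha> *\<^sub>R (transpose B ** X ** B))"
  using assms
  by (auto simp: pos_def_def pos_semidef_def transpose_add transpose_scalar matrix_transpose_mul
      matrix_mul_assoc matrix_vector_push inner_add_right inner_transpose_vector
      simp del: transpose_matrix_vector
      intro!: add_pos_nonneg)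

lemma transpose_dare_map:
  assumes "pos_semidef Q" "pos_def R" "0 < \<alpha>" "pos_semidef X"
  shows "transpose (dare_map A B Q R \<alpha> X) = dare_map A B Q R \<alpha> X"
  using assms transpose_matrix_inv[OF pos_def_control[OF assms(2-4)], of B]
  by (simp add: dare_map_def pos_semidef_transpose transpose_add transpose_diff transpose_scalar
      matrix_transpose_mul matrix_mul_assoc)

text \<open>The Bellman form of the map: as a function of the control, the right-hand side is a
  quadratic with Hessian part \<open>M\<close> and linear part \<open>b\<close>. Completing the
  square gives an inequality for every control and equality at the gain.\<close>

lemma qform_dare_map:
  fixes A :: "real^'n^'n" and B :: "real^'m^'n"
  assumes "pos_def R" "0 < \<alpha>" "pos_semidef X"
  shows "qform (dare_map A B Q R \<alpha> X) x
      \<le> qform Q x + qform R u + \<alpha> * qform X (A *v x + B *v u)"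
    and "qform (dare_map A B Q R \<alpha> X) x
      = qform Q x + qform R (dare_gain A B R \<alpha> X *v x)
        + \<alpha> * qform X (A *v x + B *v (dare_gain A B R \<alpha> X *v x))"
proof -
  define M where "M = R + \<alpha> *\<^sub>R (transpose B ** X ** B)"
  define b where "b = \<alpha> *\<^sub>R (transpose B *v (X *v (A *v x)))"
  have M: "pos_def M"
    unfolding M_def by (rule pos_def_control[OF assms])
  have cross: "(A *v x) \<bullet> (X *v (B *v v)) = (transpose B *v (X *v (A *v x))) \<bullet> v" for v
    by (metis assms(3) inner_commute inner_matrix_vector_left pos_semidef_transpose)
  have cross': "(B *v v) \<bullet> (X *v (A *v x)) = (transpose B *v (X *v (A *v x))) \<bullet> v" for v
    by (metis inner_commute inner_matrix_vector_left)
  have lhs: "qform (dare_map A B Q R \<alpha> X) x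
      = qform Q x + \<alpha> * qform X (A *v x) - b \<bullet> (matrix_inv M *v b)"
    by (simp add: dare_map_def M_def[symmetric] b_def matrix_vector_push inner_add_right inner_diff_right
        inner_transpose_vector cross power2_eq_square
        del: transpose_matrix_vector)
  have rhs: "qform Q x + qform R v + \<alpha> * qform X (A *v x + B *v v)
      = qform Q x + \<alpha> * qform X (A *v x) + (qform M v + 2 * (v \<bullet> b))" for v
    by (simp add: M_def b_def matrix_vector_push inner_add_left inner_add_right
        inner_transpose_vector cross[of v] inner_commute[of v "transpose B *v _"] cross' algebra_simps
        del: transpose_matrix_vector)
  show "qform (dare_map A B Q R \<alpha> X) x
      \<le> qform Q x + qform R u + \<alpha> * qform X (A *v x + B *v u)"
    unfolding lhs rhs using quadratic_lower_bound(1)[OF M, of b u] by simp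
  have gain: "dare_gain A B R \<alpha> X *v x = - (matrix_inv M *v b)"
    by (simp add: dare_gain_def M_def b_def matrix_vector_push
        matrix_vector_uminus del: transpose_matrix_vector)
  show "qform (dare_map A B Q R \<alpha> X) x
      = qform Q x + qform R (dare_gain A B R \<alpha> X *v x)
        + \<alpha> * qform X (A *v x + B *v (dare_gain A B R \<alpha> X *v x))"
    unfolding lhs rhs unfolding gain using quadratic_lower_bound(2)[OF M, of b] by simp
qed

text \<open>A minimum of larger functions is larger: the control that is optimal for
  \<open>Y\<close> is merely a competitor for \<open>X\<close>.\<close>

lemma dare_map_mono:
  assumes "pos_semidef Q" "pos_def R" "0 < \<alpha>" "pos_semidef X" "pos_semidef Y" "pos_semidef (Y - X)"
  shows "pos_semidef (dare_map A B Q R \<alpha> Y - dare_map A B Q R \<alpha> X)"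
proof -
  have "qform (dare_map A B Q R \<alpha> X) x \<le> qform (dare_map A B Q R \<alpha> Y) x" for x
  proof -
    let ?u = "dare_gain A B R \<alpha> Y *v x"
    have "qform X (A *v x + B *v ?u) \<le> qform Y (A *v x + B *v ?u)"
      using assms pos_semidef_diff_iff pos_semidef_transpose by metis
    then have "\<alpha> * qform X (A *v x + B *v ?u) \<le> \<alpha> * qform Y (A *v x + B *v ?u)"
      using assms by simp
    then show ?thesis
      using qform_dare_map(1)[OF assms(2,3,4), where A=A and B=B and Q=Q and x=x and u="?u"]
        qform_dare_map(2)[OF assms(2,3,5), where A=A and B=B and Q=Q and x=x]
      by simp
  qed
  then show ?thesis
    using assms by (simp add: pos_semidef_diff_iff transpose_dare_map)
qed

lemma pos_semidef_dare_map:
  assumes "pos_semidef Q" "pos_def R" "0 < \<alpha>" "pos_semidef X"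
  shows "pos_semidef (dare_map A B Q R \<alpha> X)"
  using assms pos_def_imp_semidef[OF assms(2)]
  unfolding pos_semidef_def[of "dare_map A B Q R \<alpha> X"]
  by (auto simp: transpose_dare_map qform_dare_map(2) pos_semidef_def)

subsection \<open>The inner maximization\<close>

text \<open>The map \<open>G\<close> of the overview. It is also the matrix enclosed by the factors
  \<open>B\<close> in \<open>ctrl_mat\<close>, which is why the penalized equation becomes a Riccati
  equation evaluated here.\<close>

definition penalty_map :: "real^'l^'n \<Rightarrow> real \<Rightarrow> real \<Rightarrow> real^'n^'n \<Rightarrow> real^'n^'n" where
  "penalty_map \<Xi> \<alpha> lam P =
     P + \<alpha> *\<^sub>R (P ** \<Xi> ** matrix_inv (pen_mat \<Xi> \<alpha> lam P) ** transpose \<Xi> ** P)"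

lemma qform_pen_mat: "qform (pen_mat \<Xi> \<alpha> lam P) w = lam * (w \<bullet> w) - \<alpha> * qform P (\<Xi> *v w)"
  by (simp add: pen_mat_def matrix_vector_push inner_diff_right inner_transpose_vector
      del: transpose_matrix_vector)

lemma transpose_pen_mat: "transpose P = P \<Longrightarrow> transpose (pen_mat \<Xi> \<alpha> lam P) = pen_mat \<Xi> \<alpha> lam P"
  by (simp add: pen_mat_def transpose_diff transpose_scalar matrix_transpose_mul matrix_mul_assoc)

text \<open>By \<open>qform_pen_mat\<close> the form grows when the penalty grows and when the
  matrix shrinks. Admissibility of \<open>Y\<close> is thus inherited by everything below it and by
  all larger penalties.\<close>

lemma pos_def_pen_mat_mono:
  assumes "pos_def (pen_mat \<Xi> \<alpha> lam Y)" "pos_semidef X" "pos_semidef Y" "pos_semidef (Y - X)"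
    "0 < \<alpha>" "lam \<le> lam'"
  shows "pos_def (pen_mat \<Xi> \<alpha> lam' X)"
proof -
  have "0 < qform (pen_mat \<Xi> \<alpha> lam' X) w" if "w \<noteq> 0" for w
  proof -
    have "qform X (\<Xi> *v w) \<le> qform Y (\<Xi> *v w)"
      using assms pos_semidef_diff_iff pos_semidef_transpose by metis
    then have "\<alpha> * qform X (\<Xi> *v w) \<le> \<alpha> * qform Y (\<Xi> *v w)"
      using assms by simp
    moreover have "lam * (w \<bullet> w) \<le> lam' * (w \<bullet> w)"
      using assms by (intro mult_right_mono) auto
    moreover have "0 < qform (pen_mat \<Xi> \<alpha> lam Y) w"
      using assms that by (simp add: pos_def_def)
    ultimately show ?thesis
      unfolding qform_pen_mat by linarith
  qed
  then show ?thesis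
    using assms by (simp add: pos_def_def transpose_pen_mat pos_semidef_transpose)
qed

lemma transpose_penalty_map:
  assumes "pos_semidef P" "pos_def (pen_mat \<Xi> \<alpha> lam P)"
  shows "transpose (penalty_map \<Xi> \<alpha> lam P) = penalty_map \<Xi> \<alpha> lam P"
  using assms
  by (simp add: penalty_map_def pos_semidef_transpose transpose_matrix_inv transpose_add
      transpose_scalar matrix_transpose_mul matrix_mul_assoc)

text \<open>
  The correction term is the value of maximizing
  \<open>(x + \<Xi> w)\<^sup>T P (x + \<Xi> w) - (lam / \<alpha>) \<bar>w\<bar>\<^sup>2\<close> over the disturbance \<open>w\<close>.
\<close>

lemma qform_penalty_map:
  assumes "pos_semidef P" "pos_def (pen_mat \<Xi> \<alpha> lam P)" "0 < \<alpha>"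
  shows "qform P (x + \<Xi> *v w) - lam / \<alpha> * (w \<bullet> w) \<le> qform (penalty_map \<Xi> \<alpha> lam P) x"
    and "\<exists>w. qform (penalty_map \<Xi> \<alpha> lam P) x = qform P (x + \<Xi> *v w) - lam / \<alpha> * (w \<bullet> w)"
proof -
  define M where "M = pen_mat \<Xi> \<alpha> lam P"
  define b where "b = \<alpha> *\<^sub>R (transpose \<Xi> *v (P *v x))"
  have M: "pos_def M"
    using assms by (simp add: M_def)
  have cross: "x \<bullet> (P *v (\<Xi> *v v)) = (transpose \<Xi> *v (P *v x)) \<bullet> v" for v
    by (metis assms(1) inner_commute inner_matrix_vector_left pos_semidef_transpose)
  have cross': "(\<Xi> *v v) \<bullet> (P *v x) = (transpose \<Xi> *v (P *v x)) \<bullet> v" for v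
    by (metis inner_commute inner_matrix_vector_left)
  \<comment> \<open>Both sides are scaled by \<open>\<alpha>\<close> because \<open>pen_mat\<close>
    carries \<open>lam\<close> where the maximization has \<open>lam / \<alpha>\<close>.\<close>
  have lhs: "\<alpha> * qform (penalty_map \<Xi> \<alpha> lam P) x = \<alpha> * qform P x + b \<bullet> (matrix_inv M *v b)"
    by (simp add: penalty_map_def M_def[symmetric] b_def matrix_vector_push inner_add_right
        inner_transpose_vector cross algebra_simps del: transpose_matrix_vector)
  have rhs: "\<alpha> * (qform P (x + \<Xi> *v v) - lam / \<alpha> * (v \<bullet> v))
      = \<alpha> * qform P x + (2 * (v \<bullet> b) - qform M v)" for v
    using assms(3)
    by (simp add: M_def qform_pen_mat b_def matrix_vector_push inner_add_left inner_add_right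
        cross cross' inner_commute[of v "transpose \<Xi> *v _"] algebra_simps
        del: transpose_matrix_vector)
  have "\<alpha> * (qform P (x + \<Xi> *v w) - lam / \<alpha> * (w \<bullet> w)) \<le> \<alpha> * qform (penalty_map \<Xi> \<alpha> lam P) x"
    unfolding lhs rhs using quadratic_upper_bound(1)[OF M, of w b] by simp
  then show "qform P (x + \<Xi> *v w) - lam / \<alpha> * (w \<bullet> w) \<le> qform (penalty_map \<Xi> \<alpha> lam P) x"
    using assms(3) by simp
  have "\<alpha> * qform (penalty_map \<Xi> \<alpha> lam P) x
      = \<alpha> * (qform P (x + \<Xi> *v (matrix_inv M *v b))
          - lam / \<alpha> * ((matrix_inv M *v b) \<bullet> (matrix_inv M *v b)))"
    unfolding lhs rhs quadratic_upper_bound(2)[OF M, of b] ..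
  then show "\<exists>w. qform (penalty_map \<Xi> \<alpha> lam P) x = qform P (x + \<Xi> *v w) - lam / \<alpha> * (w \<bullet> w)"
    using assms(3) by auto
qed

text \<open>The disturbance that is worst for \<open>X\<close> at \<open>lam'\<close> is only a
  competitor for \<open>Y\<close> at \<open>lam\<close>, where it earns at least as much and is
  charged no more. One statement covers monotonicity in the matrix and antitonicity in the
  penalty.\<close>

lemma penalty_map_mono:
  assumes "pos_def (pen_mat \<Xi> \<alpha> lam Y)" "pos_semidef X" "pos_semidef Y" "pos_semidef (Y - X)"
    "0 < \<alpha>" "lam \<le> lam'"
  shows "pos_semidef (penalty_map \<Xi> \<alpha> lam Y - penalty_map \<Xi> \<alpha> lam' X)"
proof -
  have X: "pos_def (pen_mat \<Xi> \<alpha> lam' X)"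
    by (rule pos_def_pen_mat_mono[OF assms])
  have "qform (penalty_map \<Xi> \<alpha> lam' X) x \<le> qform (penalty_map \<Xi> \<alpha> lam Y) x" for x
  proof -
    obtain w where w: "qform (penalty_map \<Xi> \<alpha> lam' X) x
        = qform X (x + \<Xi> *v w) - lam' / \<alpha> * (w \<bullet> w)"
      using qform_penalty_map(2)[OF assms(2) X assms(5)] by blast
    have "qform X (x + \<Xi> *v w) \<le> qform Y (x + \<Xi> *v w)"
      using assms pos_semidef_diff_iff pos_semidef_transpose by metis
    moreover have "lam / \<alpha> * (w \<bullet> w) \<le> lam' / \<alpha> * (w \<bullet> w)"
      using assms by (intro mult_right_mono divide_right_mono) auto
    moreover have "qform Y (x + \<Xi> *v w) - lam / \<alpha> * (w \<bullet> w) \<le> qform (penalty_map \<Xi> \<alpha> lam Y) x"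
      by (rule qform_penalty_map(1)[OF assms(3,1,5)])
    ultimately show ?thesis
      unfolding w by linarith
  qed
  then show ?thesis
    using assms X by (simp add: pos_semidef_diff_iff transpose_penalty_map)
qed

lemma pos_semidef_penalty_map:
  assumes "pos_semidef P" "pos_def (pen_mat \<Xi> \<alpha> lam P)" "0 < \<alpha>"
  shows "pos_semidef (penalty_map \<Xi> \<alpha> lam P)"
proof -
  have "0 \<le> qform (penalty_map \<Xi> \<alpha> lam P) x" for x
    \<comment> \<open>The competitor \<open>w = 0\<close> shows that the form dominates that of
      \<open>P\<close>.\<close>
    using qform_penalty_map(1)[OF assms, of x 0] assms(1)
    by (simp add: pos_semidef_def) (metis order_trans)
  then show ?thesis
    using assms by (simp add: pos_semidef_def[of "penalty_map \<Xi> \<alpha> lam P"] transpose_penalty_map)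
qed

section \<open>The penalized equation and gain in terms of \<open>penalty_map\<close>\<close>

lemma ctrl_mat_eq: "ctrl_mat B \<Xi> R \<alpha> lam P =
    R + \<alpha> *\<^sub>R (transpose B ** penalty_map \<Xi> \<alpha> lam P ** B)"
  by (simp add: ctrl_mat_def penalty_map_def)

lemma mult_amp_mat: "P ** amp_mat \<Xi> \<alpha> lam P = penalty_map \<Xi> \<alpha> lam P"
  by (simp add: matrix_eq amp_mat_def penalty_map_def matrix_vector_push del: transpose_matrix_vector)

lemma transpose_amp_mat_mult:
  assumes "pos_semidef P" "pos_def (pen_mat \<Xi> \<alpha> lam P)"
  shows "transpose (amp_mat \<Xi> \<alpha> lam P) ** P = penalty_map \<Xi> \<alpha> lam P"
proof -
  have "transpose (P ** amp_mat \<Xi> \<alpha> lam P) = penalty_map \<Xi> \<alpha> lam P"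
    by (simp add: mult_amp_mat transpose_penalty_map assms)
  then show ?thesis
    by (simp add: matrix_transpose_mul pos_semidef_transpose assms(1))
qed

lemma pen_gain_eq:
  assumes "pos_semidef P"
  shows "pen_gain A B \<Xi> R \<alpha> lam P = dare_gain A B R \<alpha> (penalty_map \<Xi> \<alpha> lam P)"
proof -
  have "(P *v (amp_mat \<Xi> \<alpha> lam P *v x)) = penalty_map \<Xi> \<alpha> lam P *v x" for x
    by (simp add: matrix_vector_mul_assoc mult_amp_mat)
  then show ?thesis
    using assms
    by (simp add: matrix_eq pen_gain_def dare_gain_def ctrl_mat_eq pos_semidef_transpose
      matrix_vector_uminus matrix_vector_push del: transpose_matrix_vector)
qed

text \<open>The first summand of \<open>S_mat\<close> is what \<open>penalty_map\<close> adds to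
  \<open>P\<close>, up to a factor \<open>\<alpha>\<close>, so it combines with the term
  \<open>\<alpha> *\<^sub>R (transpose A ** P ** A)\<close>. In the second summand each factor
  \<open>amp_mat\<close> merges with the adjacent \<open>P\<close> into
  \<open>penalty_map\<close>.\<close>

lemma pen_riccati_solution_iff:
  "pen_riccati_solution A B \<Xi> Q R \<alpha> lam P \<longleftrightarrow>
     pos_semidef P \<and> pos_def (pen_mat \<Xi> \<alpha> lam P) \<and>
     P = dare_map A B Q R \<alpha> (penalty_map \<Xi> \<alpha> lam P)"
proof -
  have "Q + \<alpha> *\<^sub>R (transpose A ** P ** A) + \<alpha>\<^sup>2 *\<^sub>R (transpose A ** S_mat B \<Xi> R \<alpha> lam P ** A)
      = dare_map A B Q R \<alpha> (penalty_map \<Xi> \<alpha> lam P)"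
    if P: "pos_semidef P" "pos_def (pen_mat \<Xi> \<alpha> lam P)"
  proof -
    have amp: "P *v (amp_mat \<Xi> \<alpha> lam P *v x) = penalty_map \<Xi> \<alpha> lam P *v x"
      "transpose (amp_mat \<Xi> \<alpha> lam P) *v (P *v x) = penalty_map \<Xi> \<alpha> lam P *v x" for x
      by (simp_all add: matrix_vector_mul_assoc mult_amp_mat transpose_amp_mat_mult P
          del: transpose_matrix_vector)
    have corr: "\<alpha> *\<^sub>R (P *v (\<Xi> *v (matrix_inv (pen_mat \<Xi> \<alpha> lam P) *v (transpose \<Xi> *v (P *v x)))))
        = penalty_map \<Xi> \<alpha> lam P *v x - P *v x" for x
      by (simp add: penalty_map_def matrix_vector_push del: transpose_matrix_vector)
    show ?thesis
      unfolding matrix_eq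
    proof
      fix x
      have "\<alpha>\<^sup>2 *\<^sub>R (transpose A *v (P *v (\<Xi> *v (matrix_inv (pen_mat \<Xi> \<alpha> lam P)
              *v (transpose \<Xi> *v (P *v (A *v x)))))))
          = \<alpha> *\<^sub>R (transpose A *v (\<alpha> *\<^sub>R (P *v (\<Xi> *v (matrix_inv (pen_mat \<Xi> \<alpha> lam P)
              *v (transpose \<Xi> *v (P *v (A *v x))))))))"
        by (simp add: matrix_vector_mult_scaleR power2_eq_square del: transpose_matrix_vector)
      also have "\<dots> = \<alpha> *\<^sub>R (transpose A *v (penalty_map \<Xi> \<alpha> lam P *v (A *v x)))
          - \<alpha> *\<^sub>R (transpose A *v (P *v (A *v x)))"
        unfolding corr by (simp add: matrix_vector_push scaleR_diff_right del: transpose_matrix_vector)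
      finally show "(Q + \<alpha> *\<^sub>R (transpose A ** P ** A)
            + \<alpha>\<^sup>2 *\<^sub>R (transpose A ** S_mat B \<Xi> R \<alpha> lam P ** A)) *v x
          = dare_map A B Q R \<alpha> (penalty_map \<Xi> \<alpha> lam P) *v x"
        by (simp add: S_mat_def dare_map_def ctrl_mat_eq matrix_vector_push amp scaleR_diff_right
            del: transpose_matrix_vector)
    qed
  qed
  then show ?thesis
    by (auto simp: pen_riccati_solution_def)
qed

subsection \<open>Limits of matrices\<close>

lemma tendsto_matrix_mult [tendsto_intros]:
  fixes f :: "'c \<Rightarrow> real^'b^'a" and g :: "'c \<Rightarrow> real^'d^'b"
  assumes "(f \<longlongrightarrow> M) F" "(g \<longlongrightarrow> N) F"
  shows "((\<lambda>x. f x ** g x) \<longlongrightarrow> M ** N) F"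
  unfolding matrix_matrix_mult_def
  by (intro vec_tendstoI) (auto intro!: tendsto_intros assms)

lemma tendsto_matrix_vector_mult [tendsto_intros]:
  fixes f :: "'c \<Rightarrow> real^'b^'a" and g :: "'c \<Rightarrow> real^'b"
  assumes "(f \<longlongrightarrow> M) F" "(g \<longlongrightarrow> v) F"
  shows "((\<lambda>x. f x *v g x) \<longlongrightarrow> M *v v) F"
  unfolding matrix_vector_mult_def
  by (intro vec_tendstoI) (auto intro!: tendsto_intros assms)

lemma tendsto_det:
  fixes f :: "'c \<Rightarrow> real^'a^'a"
  assumes "(f \<longlongrightarrow> M) F"
  shows "((\<lambda>x. det (f x)) \<longlongrightarrow> det M) F"
  unfolding det_def by (intro tendsto_intros assms)

text \<open>Column \<open>k\<close> of the inverse solves a linear system with right-hand side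
  \<open>axis k 1\<close>. Cramer's rule then makes every entry a quotient of determinants, from
  which continuity of inversion follows.\<close>

lemma matrix_inv_cramer:
  fixes M :: "real^'a^'a"
  assumes "det M \<noteq> 0"
  shows "matrix_inv M $ i $ k
    = det (\<chi> p q. if q = i then axis k 1 $ p else M $ p $ q) / det M"
proof -
  have "M *v (matrix_inv M *v axis k 1) = axis k 1"
    using assms by (simp add: matrix_vector_mul_assoc matrix_inv_inverse invertible_det_nz)
  then have "matrix_inv M *v axis k 1
      = (\<chi> i. det (\<chi> p q. if q = i then axis k 1 $ p else M $ p $ q) / det M)"
    using cramer[OF assms] by blast
  then have "(matrix_inv M *v axis k 1) $ i
      = det (\<chi> p q. if q = i then axis k 1 $ p else M $ p $ q) / det M"
    by simp
  then show ?thesis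
    by (simp add: matrix_vector_mult_basis column_def)
qed

lemma eventually_invertible:
  fixes f :: "'c \<Rightarrow> real^'a^'a"
  assumes "(f \<longlongrightarrow> M) F" "invertible M"
  shows "\<forall>\<^sub>F x in F. invertible (f x)"
  using tendsto_imp_eventually_ne[OF tendsto_det[OF assms(1)], of 0] assms(2)
  by (simp add: invertible_det_nz)

lemma tendsto_matrix_inv:
  fixes f :: "'c \<Rightarrow> real^'a^'a"
  assumes "(f \<longlongrightarrow> M) F" "invertible M"
  shows "((\<lambda>x. matrix_inv (f x)) \<longlongrightarrow> matrix_inv M) F"
proof (intro vec_tendstoI)
  fix i k
  \<comment> \<open>Column \<open>i\<close> is replaced by the unit vector \<open>axis k 1\<close>,
    as in Cramer's rule for entry \<open>(i, k)\<close>.\<close>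
  define E where "E N = (\<chi> p q. if q = i then axis k 1 $ p else N $ p $ q)" for N :: "real^'a^'a"
  have M: "det M \<noteq> 0"
    using assms(2) by (simp add: invertible_det_nz)
  have "((\<lambda>x. E (f x)) \<longlongrightarrow> E M) F"
    unfolding E_def by (intro vec_tendstoI) (auto intro!: tendsto_intros assms)
  then have "((\<lambda>x. det (E (f x)) / det (f x)) \<longlongrightarrow> det (E M) / det M) F"
    by (intro tendsto_divide tendsto_det assms M)
  moreover have "\<forall>\<^sub>F x in F. det (E (f x)) / det (f x) = matrix_inv (f x) $ i $ k"
    using eventually_invertible[OF assms]
    by eventually_elim (simp add: E_def matrix_inv_cramer invertible_det_nz)
  ultimately show "((\<lambda>x. matrix_inv (f x) $ i $ k) \<longlongrightarrow> matrix_inv M $ i $ k) F"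
    unfolding matrix_inv_cramer[OF M] E_def[symmetric] by (rule Lim_transform_eventually)
qed

lemma tendsto_transpose:
  fixes f :: "'c \<Rightarrow> real^'b^'a"
  assumes "(f \<longlongrightarrow> M) F"
  shows "((\<lambda>x. transpose (f x)) \<longlongrightarrow> transpose M) F"
  unfolding transpose_def by (intro vec_tendstoI) (auto intro!: tendsto_intros assms)

lemma pos_semidef_tendsto:
  assumes "(f \<longlongrightarrow> M) F" "\<forall>\<^sub>F x in F. pos_semidef (f x)" "F \<noteq> bot"
  shows "pos_semidef M"
  unfolding pos_semidef_def
proof (intro conjI allI)
  \<comment> \<open>Eventually \<open>f\<close> agrees with its transpose, so it has both limits;
    they coincide because \<open>F\<close> is not trivial.\<close>
  have "(f \<longlongrightarrow> transpose M) F"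
    using tendsto_transpose[OF assms(1)]
    by (rule Lim_transform_eventually)
      (use assms(2) in \<open>auto simp: pos_semidef_def elim: eventually_mono\<close>)
  then show "transpose M = M"
    using assms tendsto_unique by blast
  fix x
  have "((\<lambda>y. qform (f y) x) \<longlongrightarrow> qform M x) F"
    by (intro tendsto_intros assms)
  then show "0 \<le> qform M x"
    by (rule tendsto_lowerbound)
      (use assms in \<open>auto simp: pos_semidef_def elim: eventually_mono\<close>)
qed

section \<open>Monotone convergence in the Loewner order\<close>

lemma bounded_mono_tendsto:
  fixes f :: "'i::linorder \<Rightarrow> real"
  assumes "\<And>i j. m \<le> i \<Longrightarrow> i \<le> j \<Longrightarrow> f i \<le> f j" "\<And>i. m \<le> i \<Longrightarrow> f i \<le> b"
  shows "\<exists>l. (f \<longlongrightarrow> l) at_top"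
proof -
  define l where "l = Sup (f ` {m..})"
  have bdd: "bdd_above (f ` {m..})"
    by (rule bdd_aboveI[of _ b]) (use assms in auto)
  have "(f \<longlongrightarrow> l) at_top"
  proof (rule increasing_tendsto)
    show "\<forall>\<^sub>F i in at_top. f i \<le> l"
      using eventually_ge_at_top[of m]
      by eventually_elim (auto simp: l_def intro!: cSup_upper bdd)
    fix y assume "y < l"
    then obtain i where i: "m \<le> i" "y < f i"
      using less_cSup_iff[OF _ bdd, of y] by (auto simp: l_def)
    show "\<forall>\<^sub>F j in at_top. y < f j"
      using eventually_ge_at_top[of i]
      by eventually_elim (use i assms(1)[of i] in force)
  qed
  then show ?thesis ..
qed

lemma qform_polarization:
  assumes "transpose M = M"
  shows "M $ i $ j = (qform M (axis i 1 + axis j 1) - qform M (axis i 1 - axis j 1)) / 4"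
proof -
  have "axis i 1 \<bullet> (M *v axis j 1) = M $ i $ j" for i j
    by (simp add: matrix_vector_mult_basis column_def inner_axis')
  moreover have "M $ j $ i = M $ i $ j"
    by (subst assms[symmetric]) (simp add: transpose_def)
  ultimately show ?thesis
    by (simp add: matrix_vector_push inner_add_left inner_add_right inner_diff_left inner_diff_right)
qed

text \<open>Each quadratic form is a bounded increasing real function, and polarization expresses
  the entries through finitely many such forms. The index is an arbitrary linear order so that the
  result serves both iterates and the real penalty.\<close>

lemma loewner_mono_tendsto:
  fixes M :: "'i::linorder \<Rightarrow> real^'n^'n"
  assumes sym: "\<And>i. m \<le> i \<Longrightarrow> transpose (M i) = M i" and "transpose Y = Y"
    and mono: "\<And>i j. m \<le> i \<Longrightarrow> i \<le> j \<Longrightarrow> pos_semidef (M j - M i)"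
    and bd: "\<And>i. m \<le> i \<Longrightarrow> pos_semidef (Y - M i)"
  shows "\<exists>L. (M \<longlongrightarrow> L) at_top"
proof -
  have "\<exists>l. ((\<lambda>i. qform (M i) x) \<longlongrightarrow> l) at_top" for x
  proof (rule bounded_mono_tendsto)
    show "qform (M i) x \<le> qform (M j) x" if "m \<le> i" "i \<le> j" for i j
      using mono[OF that] sym that order_trans[OF that] by (simp add: pos_semidef_diff_iff)
    show "qform (M i) x \<le> qform Y x" if "m \<le> i" for i
      using bd[OF that] sym that assms(2) by (simp add: pos_semidef_diff_iff)
  qed
  then obtain l where l: "\<And>x. ((\<lambda>i. qform (M i) x) \<longlongrightarrow> l x) at_top"
    by metis
  have "(M \<longlongrightarrow> (\<chi> p q. (l (axis p 1 + axis q 1) - l (axis p 1 - axis q 1)) / 4)) at_top"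
  proof (intro vec_tendstoI)
    fix p q
    have "((\<lambda>i. (qform (M i) (axis p 1 + axis q 1) - qform (M i) (axis p 1 - axis q 1)) / 4)
        \<longlongrightarrow> (l (axis p 1 + axis q 1) - l (axis p 1 - axis q 1)) / 4) at_top"
      by (intro tendsto_intros l) auto
    then have "((\<lambda>i. M i $ p $ q) \<longlongrightarrow> (l (axis p 1 + axis q 1) - l (axis p 1 - axis q 1)) / 4) at_top"
      by (rule Lim_transform_eventually)
        (use eventually_ge_at_top[of m] in eventually_elim, simp add: qform_polarization[OF sym])
    then show "((\<lambda>i. M i $ p $ q) \<longlongrightarrow> (\<chi> p q. (l (axis p 1 + axis q 1) - l (axis p 1 - axis q 1)) / 4) $ p $ q) at_top"
      by simp
  qed
  then show ?thesis ..
qed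

section \<open>Continuity of the Riccati map, the gain and the penalty map\<close>

lemma tendsto_dare_map:
  assumes "pos_def R" "0 < \<alpha>" "pos_semidef L" "(f \<longlongrightarrow> L) F"
  shows "((\<lambda>x. dare_map A B Q R \<alpha> (f x)) \<longlongrightarrow> dare_map A B Q R \<alpha> L) F"
  unfolding dare_map_def
  by (intro tendsto_intros tendsto_matrix_inv assms pos_def_invertible pos_def_control)

lemma tendsto_dare_gain:
  assumes "pos_def R" "0 < \<alpha>" "pos_semidef L" "(f \<longlongrightarrow> L) F"
  shows "((\<lambda>x. dare_gain A B R \<alpha> (f x)) \<longlongrightarrow> dare_gain A B R \<alpha> L) F"
  unfolding dare_gain_def
  by (intro tendsto_intros tendsto_matrix_inv assms pos_def_invertible pos_def_control)

lemma tendsto_penalty_map: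
  assumes "pos_def (pen_mat \<Xi> \<alpha> lam L)" "(f \<longlongrightarrow> L) F"
  shows "((\<lambda>x. penalty_map \<Xi> \<alpha> lam (f x)) \<longlongrightarrow> penalty_map \<Xi> \<alpha> lam L) F"
  using assms unfolding penalty_map_def pen_mat_def
  by (intro tendsto_intros tendsto_matrix_inv assms pos_def_invertible)

subsection \<open>Solutions below a supersolution\<close>

text \<open>Monotone iteration from 0. The supersolution \<open>Y\<close> caps the iterates, which
  keeps the penalty matrices positive definite and forces convergence; continuity makes the limit a
  fixed point.\<close>

lemma ex_pen_riccati_solution_below:
  fixes A :: "real^'n^'n"
  assumes Q: "pos_semidef Q" and R: "pos_def R" and \<alpha>: "0 < \<alpha>"
    and Y: "pos_semidef Y" "pos_def (pen_mat \<Xi> \<alpha> lam Y)"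
    and super: "pos_semidef (Y - dare_map A B Q R \<alpha> (penalty_map \<Xi> \<alpha> lam Y))"
  shows "\<exists>X. pen_riccati_solution A B \<Xi> Q R \<alpha> lam X \<and> pos_semidef (Y - X)"
proof -
  define T where "T X = dare_map A B Q R \<alpha> (penalty_map \<Xi> \<alpha> lam X)" for X
  define Z where "Z k = (T ^^ k) 0" for k
  note trans = pos_semidef_trans
  have pen: "pos_def (pen_mat \<Xi> \<alpha> lam X)" if "pos_semidef X" "pos_semidef (Y - X)" for X
    using pos_def_pen_mat_mono[OF Y(2) that(1) Y(1) that(2) \<alpha> order_refl] .
  have T_psd: "pos_semidef (T X)" if "pos_semidef X" "pos_semidef (Y - X)" for X
    unfolding T_def by (intro pos_semidef_dare_map pos_semidef_penalty_map pen that Q R \<alpha>)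
  have T_mono: "pos_semidef (T X' - T X)"
    if "pos_semidef X" "pos_semidef X'" "pos_semidef (X' - X)" "pos_semidef (Y - X')" for X X'
  proof -
    have "pos_semidef (Y - X)"
      using trans that by blast
    then show ?thesis
      unfolding T_def using that
      by (intro dare_map_mono pos_semidef_penalty_map penalty_map_mono pen Q R \<alpha>) auto
  qed
  \<comment> \<open>The three claims need a joint induction, since \<open>T\<close> is known to be
    monotone only between 0 and \<open>Y\<close>.\<close>
  have Z: "pos_semidef (Z k) \<and> pos_semidef (Y - Z k) \<and> pos_semidef (Z (Suc k) - Z k)" for k
  proof (induction k)
    case 0
    have "pos_semidef (0 :: real^'n^'n)"
      using pos_semidef_refl[of 0] by simp
    then show ?case
      using Y T_psd[of 0] by (simp add: Z_def)
  next
    case (Suc k)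
    have "pos_semidef (T Y - T (Z k))"
      using Suc Y by (intro T_mono pos_semidef_refl) auto
    then have "pos_semidef (Y - T (Z k))"
      using super trans by (simp add: T_def) blast
    moreover have "pos_semidef (T (Z k))"
      using Suc T_psd by blast
    moreover have "Z (Suc k) = T (Z k)" "Z (Suc (Suc k)) = T (Z (Suc k))"
      by (simp_all add: Z_def)
    ultimately show ?case
      using T_mono[of "Z k" "Z (Suc k)"] Suc by simp
  qed
  have "pos_semidef (Z j - Z i)" if "i \<le> j" for i j
    using that
  proof (induction j rule: dec_induct)
    case base
    show ?case
      by (rule pos_semidef_refl)
  next
    case (step j)
    then show ?case
      using Z trans by blast
  qed
  then have "\<exists>L. Z \<longlonglongrightarrow> L"
    using Z Y(1) by (intro loewner_mono_tendsto[where m = 0 and Y = Y]) (auto simp: pos_semidef_transpose)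
  then obtain L where L: "Z \<longlonglongrightarrow> L" ..
  have L_psd: "pos_semidef L"
    by (rule pos_semidef_tendsto[OF L]) (use Z in auto)
  have "(\<lambda>k. Y - Z k) \<longlonglongrightarrow> Y - L"
    by (intro tendsto_intros L)
  then have YL: "pos_semidef (Y - L)"
    by (rule pos_semidef_tendsto) (use Z in auto)
  have "(\<lambda>k. T (Z k)) \<longlonglongrightarrow> T L"
    unfolding T_def
    by (intro tendsto_dare_map tendsto_penalty_map pos_semidef_penalty_map pen L L_psd YL R \<alpha>)
  moreover have "(\<lambda>k. T (Z k)) \<longlonglongrightarrow> L"
    using LIMSEQ_Suc[OF L] by (simp add: Z_def)
  ultimately have "L = T L"
    using LIMSEQ_unique by blast
  then show ?thesis
    using L_psd YL pen T_def pen_riccati_solution_iff by metis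
qed

subsection \<open>Uniqueness for the Riccati equation\<close>

text \<open>If the feedback input vanishes along the closed loop, the trajectory is that of
  \<open>A\<close> scaled by \<open>s ^ t\<close>, so zero output is zero output of the open loop.
  The factor \<open>s\<close> will be \<open>sqrt \<alpha>\<close>, which absorbs the
  discount.\<close>

lemma observable_closed_loop:
  fixes A :: "real^'n^'n" and B :: "real^'m^'n" and K :: "real^'n^'m"
  assumes "observable A C" "s \<noteq> 0"
    and "\<And>t. C *v (((*v) (s *\<^sub>R (A + B ** K)) ^^ t) z) = 0"
    and "\<And>t. K *v (((*v) (s *\<^sub>R (A + B ** K)) ^^ t) z) = 0"
  shows "z = 0"
proof -
  have orbit: "((*v) (s *\<^sub>R (A + B ** K)) ^^ t) z = s ^ t *\<^sub>R ((*v) A ^^ t) z" for t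
  proof (induction t)
    case (Suc t)
    have "((*v) (s *\<^sub>R (A + B ** K)) ^^ Suc t) z
        = s *\<^sub>R (A *v (((*v) (s *\<^sub>R (A + B ** K)) ^^ t) z))"
      by (simp add: matrix_vector_push assms(4) del: scaleR_add_right)
    also have "\<dots> = s ^ Suc t *\<^sub>R ((*v) A ^^ Suc t) z"
      by (simp add: Suc matrix_vector_mult_scaleR)
    finally show ?case .
  qed simp
  \<comment> \<open>Observability compares two initial states; here the second one is 0.\<close>
  have "((*v) A ^^ t) 0 = 0" for t
    by (induction t) auto
  moreover have "C *v (((*v) A ^^ t) z) = 0" for t
    using assms(3)[of t] assms(2) unfolding orbit by (simp add: matrix_vector_mult_scaleR)
  ultimately show ?thesis
    using assms(1) unfolding observable_def by (metis matrix_vector_mult_0_right)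
qed

text \<open>One-step energy balance: the value is the running cost plus the value at the next state.
  Scaling the closed loop by \<open>sqrt \<alpha>\<close> removes the discount factor.\<close>

lemma qform_dare_solution:
  fixes A :: "real^'n^'n" and B :: "real^'m^'n" and R :: "real^'m^'m"
  assumes "pos_def R" "0 < \<alpha>" "pos_semidef X" "dare_solution A B (transpose C ** C) R \<alpha> X"
    and "K = dare_gain A B R \<alpha> X"
  shows "qform X x = (C *v x) \<bullet> (C *v x) + qform R (K *v x)
    + qform X ((sqrt \<alpha> *\<^sub>R (A + B ** K)) *v x)"
proof -
  have "qform X x = qform (dare_map A B (transpose C ** C) R \<alpha> X) x"
    using assms(4) by (simp add: dare_solution_iff)
  also have "\<dots> = qform (transpose C ** C) x + qform R (K *v x)
      + \<alpha> * qform X (A *v x + B *v (K *v x))"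
    using qform_dare_map(2)[OF assms(1-3)] assms(5) by simp
  also have "\<alpha> * qform X (A *v x + B *v (K *v x)) = qform X ((sqrt \<alpha> *\<^sub>R (A + B ** K)) *v x)"
    using assms(2) by (simp add: matrix_vector_push inner_add_left inner_add_right algebra_simps
        flip: mult.assoc)
  finally show ?thesis
    by (simp add: matrix_vector_push inner_transpose_vector del: transpose_matrix_vector)
qed

text \<open>At a state of value zero all three nonnegative terms of the balance vanish. The next
  state therefore has value zero too, and by induction outputs and inputs vanish forever, which
  observability forbids unless the state is 0.\<close>

lemma pos_def_dare_solution:
  fixes A :: "real^'n^'n" and B :: "real^'m^'n" and R :: "real^'m^'m"
  assumes R: "pos_def R" and \<alpha>: "0 < \<alpha>" and X: "pos_semidef X"
    and sol: "dare_solution A B (transpose C ** C) R \<alpha> X" and obs: "observable A C"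
  shows "pos_def X"
proof -
  define K where "K = dare_gain A B R \<alpha> X"
  define M where "M = sqrt \<alpha> *\<^sub>R (A + B ** K)"
  note step = qform_dare_solution[OF R \<alpha> X sol K_def, folded M_def]
  have nonneg: "0 \<le> qform X x" "0 \<le> qform R u" for x u
    using X pos_def_imp_semidef[OF R] by (auto simp: pos_semidef_def)
  have "x = 0" if x: "qform X x = 0" for x
  proof -
    have zero: "qform X (((*v) M ^^ t) x) = 0" for t
    proof (induction t)
      case (Suc t)
      have "qform X (M *v (((*v) M ^^ t) x)) = 0"
        using Suc step[of "((*v) M ^^ t) x"] nonneg(1)[of "M *v (((*v) M ^^ t) x)"]
          nonneg(2)[of "K *v (((*v) M ^^ t) x)"] inner_ge_zero[of "C *v (((*v) M ^^ t) x)"]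
        by linarith
      then show ?case
        by simp
    qed (simp add: x)
    have "C *v (((*v) M ^^ t) x) = 0 \<and> K *v (((*v) M ^^ t) x) = 0" for t
    proof -
      have "(C *v (((*v) M ^^ t) x)) \<bullet> (C *v (((*v) M ^^ t) x)) = 0"
        and "qform R (K *v (((*v) M ^^ t) x)) = 0"
        using step[of "((*v) M ^^ t) x"] zero[of t] nonneg(1)[of "M *v (((*v) M ^^ t) x)"]
          nonneg(2)[of "K *v (((*v) M ^^ t) x)"] inner_ge_zero[of "C *v (((*v) M ^^ t) x)"]
        by linarith+
      then show ?thesis
        using R unfolding pos_def_def by (metis inner_eq_zero_iff less_irrefl)
    qed
    then show ?thesis
      using observable_closed_loop[OF obs, of "sqrt \<alpha>" B K x] \<alpha> by (simp add: M_def)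
  qed
  then show ?thesis
    using X nonneg(1) unfolding pos_def_def pos_semidef_def by (metis less_eq_real_def)
qed

text \<open>The constant is the minimum over the compact unit sphere; homogeneity of degree two
  extends the bound to all vectors. It bounds a trajectory along which the value does not
  increase.\<close>

lemma pos_def_coercive:
  fixes M :: "real^'k^'k"
  assumes "pos_def M"
  shows "\<exists>c>0. \<forall>x. c * (norm x)\<^sup>2 \<le> qform M x"
proof -
  have "\<exists>v\<in>sphere 0 1. \<forall>x\<in>sphere 0 1. qform M v \<le> qform M x"
    by (intro continuous_attains_inf continuous_intros) auto
  then obtain v where v: "v \<in> sphere 0 1" "\<And>x. x \<in> sphere 0 1 \<Longrightarrow> qform M v \<le> qform M x"
    by blast
  have "qform M v * (norm x)\<^sup>2 \<le> qform M x" for x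
  proof (cases "x = 0")
    case False
    define y where "y = (1 / norm x) *\<^sub>R x"
    have "x = norm x *\<^sub>R y"
      using False by (simp add: y_def)
    then have "qform M x = (norm x)\<^sup>2 * qform M y"
      by (metis (no_types, lifting) inner_scaleR_left inner_scaleR_right
          matrix_vector_mult_scaleR mult.assoc power2_eq_square)
    moreover have "qform M v \<le> qform M y"
      using False by (intro v) (simp add: y_def)
    ultimately show ?thesis
      by (simp add: mult.commute mult_right_mono)
  qed simp
  moreover have "v \<noteq> 0"
    using v(1) by auto
  then have "0 < qform M v"
    using assms by (simp add: pos_def_def)
  ultimately show ?thesis
    by blast
qed

text \<open>
  Along the closed loop of \<open>X\<close> the difference of the two quadratic forms does not decrease. The
  trajectory is bounded and its running cost is summable, so each of its cluster points generates
  a trajectory of zero cost and must vanish by observability.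
\<close>

lemma dare_solution_le:
  fixes A :: "real^'n^'n" and B :: "real^'m^'n" and R :: "real^'m^'m"
  assumes R: "pos_def R" and \<alpha>: "0 < \<alpha>" and obs: "observable A C"
    and X: "pos_def X" and sol: "dare_solution A B (transpose C ** C) R \<alpha> X"
    and Y: "pos_semidef Y" and solY: "dare_solution A B (transpose C ** C) R \<alpha> Y"
  shows "pos_semidef (X - Y)"
proof -
  define K where "K = dare_gain A B R \<alpha> X"
  define M where "M = sqrt \<alpha> *\<^sub>R (A + B ** K)"
  define q where "q x = (C *v x) \<bullet> (C *v x) + qform R (K *v x)" for x
  have X': "pos_semidef X"
    using X by (rule pos_def_imp_semidef)
  have stepX: "qform X x = q x + qform X (M *v x)" for x
    unfolding q_def by (rule qform_dare_solution[OF R \<alpha> X' sol K_def, folded M_def])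
  have stepY: "qform Y x \<le> q x + qform Y (M *v x)" for x
  proof -
    have "qform Y x \<le> qform (transpose C ** C) x + qform R (K *v x)
        + \<alpha> * qform Y (A *v x + B *v (K *v x))"
      using qform_dare_map(1)[OF R \<alpha> Y] solY by (metis dare_solution_iff)
    also have "\<alpha> * qform Y (A *v x + B *v (K *v x)) = qform Y (M *v x)"
      using \<alpha> by (simp add: M_def matrix_vector_push inner_add_left inner_add_right algebra_simps
        flip: mult.assoc)
    finally show ?thesis
      by (simp add: q_def matrix_vector_push inner_transpose_vector del: transpose_matrix_vector)
  qed
  have Rnn: "0 \<le> qform R u" for u
    using pos_def_imp_semidef[OF R] by (simp add: pos_semidef_def)
  have Xnn: "0 \<le> qform X u" for u
    using X' by (simp add: pos_semidef_def)
  have q_nonneg: "0 \<le> q x" for x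
    by (simp add: q_def Rnn)
  have "qform Y x \<le> qform X x" for x
  proof -
    define z where "z t = ((*v) M ^^ t) x" for t
    have z_Suc: "z (Suc t) = M *v z t" for t
      by (simp add: z_def)
    have dec: "qform X (z (Suc t)) \<le> qform X (z t)" for t
      using stepX[of "z t"] q_nonneg[of "z t"] by (simp add: z_Suc)
    have le0: "qform X (z t) \<le> qform X x" for t
    proof (induction t)
      case (Suc t)
      then show ?case using dec[of t] by linarith
    qed (simp add: z_def)
    have diff: "qform Y x - qform X x \<le> qform Y (z t) - qform X (z t)" for t
    proof (induction t)
      case (Suc t)
      then show ?case using stepX[of "z t"] stepY[of "z t"] by (simp add: z_Suc)
    qed (simp add: z_def)
    obtain c where c: "0 < c" "\<And>y. c * (norm y)\<^sup>2 \<le> qform X y"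
      using pos_def_coercive[OF X] by blast
    have "norm (z t) \<le> sqrt (qform X x / c)" for t
      using c(2)[of "z t"] le0[of t] c(1)
      by (intro real_le_rsqrt) (simp add: pos_le_divide_eq mult.commute)
    then have "bounded (range z)"
      by (auto simp: bounded_iff)
    then obtain l r where r: "strict_mono (r :: nat \<Rightarrow> nat)" and l: "(z \<circ> r) \<longlonglongrightarrow> l"
      using bounded_imp_convergent_subsequence by blast
    have "decseq (\<lambda>t. qform X (z t))"
      using dec by (rule decseq_SucI)
    then obtain v where v: "(\<lambda>t. qform X (z t)) \<longlonglongrightarrow> v"
      using decseq_convergent Xnn by blast
    \<comment> \<open>The running cost is a difference of consecutive terms of a convergent
      sequence.\<close>
    have "(\<lambda>t. qform X (z t) - qform X (z (Suc t))) \<longlonglongrightarrow> v - v"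
      by (intro tendsto_diff v LIMSEQ_Suc)
    moreover have "qform X (z t) - qform X (z (Suc t)) = q (z t)" for t
      using stepX[of "z t"] by (simp add: z_Suc)
    ultimately have q0: "(\<lambda>t. q (z t)) \<longlonglongrightarrow> 0"
      by simp
    have "q (((*v) M ^^ t) l) = 0" for t
    proof -
      have shift: "((*v) M ^^ t) (z k) = z (k + t)" for k
        by (simp add: z_def add.commute[of k] funpow_add)
      \<comment> \<open>For fixed \<open>t\<close>, the trajectory issuing from the cluster point
        \<open>l\<close> is a limit of shifted pieces of the original one, whose cost tends to
        0.\<close>
      have pw: "(\<lambda>k. ((*v) M ^^ t) (z (r k))) \<longlonglongrightarrow> ((*v) M ^^ t) l"
      proof (induction t)
        case 0
        show ?case using l by (simp add: o_def)
      next
        case (Suc t)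
        show ?case by (simp add: tendsto_matrix_vector_mult[OF tendsto_const Suc])
      qed
      have "(\<lambda>k. q (((*v) M ^^ t) (z (r k)))) \<longlonglongrightarrow> q (((*v) M ^^ t) l)"
        unfolding q_def by (intro tendsto_intros pw)
      moreover have "(\<lambda>k. q (z (r k + t))) \<longlonglongrightarrow> 0"
        using LIMSEQ_subseq_LIMSEQ[OF LIMSEQ_ignore_initial_segment[OF q0, of t] r]
        by (simp add: o_def)
      ultimately show ?thesis
        unfolding shift by (rule LIMSEQ_unique)
    qed
    then have "C *v (((*v) M ^^ t) l) = 0 \<and> K *v (((*v) M ^^ t) l) = 0" for t
    proof -
      assume q: "\<And>t. q (((*v) M ^^ t) l) = 0"
      have "(C *v (((*v) M ^^ t) l)) \<bullet> (C *v (((*v) M ^^ t) l)) = 0"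
        and "qform R (K *v (((*v) M ^^ t) l)) = 0"
        using q[of t] Rnn[of "K *v (((*v) M ^^ t) l)"] inner_ge_zero[of "C *v (((*v) M ^^ t) l)"]
        unfolding q_def by linarith+
      then show ?thesis
        using R unfolding pos_def_def by (metis inner_eq_zero_iff less_irrefl)
    qed
    then have "l = 0"
      using observable_closed_loop[OF obs, of "sqrt \<alpha>" B K l] \<alpha> by (simp add: M_def)
    \<comment> \<open>Along the subsequence both forms tend to 0, while by \<open>diff\<close> their
      difference never drops below its initial value. That value is therefore at most 0.\<close>
    then have "(\<lambda>k. qform Y (z (r k)) - qform X (z (r k))) \<longlonglongrightarrow> qform Y 0 - qform X 0"
      using l by (intro tendsto_intros) (simp_all add: o_def)
    then have "(\<lambda>k. qform Y (z (r k)) - qform X (z (r k))) \<longlonglongrightarrow> 0"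
      by simp
    then have "qform Y x - qform X x \<le> 0"
      by (rule tendsto_lowerbound) (simp_all add: diff)
    then show ?thesis
      by simp
  qed
  then show ?thesis
    using X' Y by (simp add: pos_semidef_diff_iff pos_semidef_transpose)
qed

lemma pos_semidef_antisym:
  assumes "pos_semidef (X - Y)" "pos_semidef (Y - X)" "transpose X = X" "transpose Y = Y"
  shows "X = Y"
proof -
  have "qform X x = qform Y x" for x
    using assms by (simp add: pos_semidef_diff_iff order_antisym)
  then show ?thesis
    by (simp only: vec_eq_iff qform_polarization[OF assms(3)] qform_polarization[OF assms(4)] simp_thms)
qed

subsection \<open>Large penalties\<close>

text \<open>Factoring \<open>lam\<close> out of the penalty matrix leaves \<open>N\<close>, which
  tends to the identity when \<open>P\<close> converges. The scaled limit treats the sample term of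
  the support points, the unscaled one every other occurrence of the inverse.\<close>

lemma tendsto_matrix_inv_pen_mat:
  fixes \<Xi> :: "real^'l^'n"
  assumes "(P \<longlongrightarrow> L) at_top"
  shows "((\<lambda>lam. lam *\<^sub>R matrix_inv (pen_mat \<Xi> \<alpha> lam (P lam))) \<longlongrightarrow> mat 1) at_top"
    and "((\<lambda>lam. matrix_inv (pen_mat \<Xi> \<alpha> lam (P lam))) \<longlongrightarrow> 0) at_top"
proof -
  define N where "N lam = mat 1 - (\<alpha> / lam) *\<^sub>R (transpose \<Xi> ** P lam ** \<Xi>)" for lam
  have "((\<lambda>lam::real. \<alpha> / lam) \<longlongrightarrow> 0) at_top"
    by (intro tendsto_divide_0[OF tendsto_const] filterlim_at_top_imp_at_infinity filterlim_ident)
  then have "(N \<longlongrightarrow> mat 1 - 0 *\<^sub>R (transpose \<Xi> ** L ** \<Xi>)) at_top"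
    unfolding N_def by (intro tendsto_intros assms)
  then have N: "(N \<longlongrightarrow> mat 1) at_top"
    by simp
  have inv1: "invertible (mat 1 :: real^'l^'l)"
    by (simp add: invertible_det_nz)
  have inv_eq: "\<forall>\<^sub>F lam in at_top. matrix_inv (N lam) = lam *\<^sub>R matrix_inv (pen_mat \<Xi> \<alpha> lam (P lam))"
    using eventually_gt_at_top[of 0] eventually_invertible[OF N inv1]
  proof eventually_elim
    case (elim lam)
    have "pen_mat \<Xi> \<alpha> lam (P lam) = lam *\<^sub>R N lam"
      using elim by (simp add: pen_mat_def N_def scaleR_diff_right)
    then have "pen_mat \<Xi> \<alpha> lam (P lam) ** ((1 / lam) *\<^sub>R matrix_inv (N lam)) = mat 1"
      using elim by (simp add: matrix_eq matrix_vector_push)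
        (simp add: matrix_vector_mul_assoc matrix_inv_inverse)
    then show ?case
      using elim by (simp add: matrix_inv_eqI)
  qed
  have "((\<lambda>lam. matrix_inv (N lam)) \<longlongrightarrow> mat 1) at_top"
    using tendsto_matrix_inv[OF N inv1] by (simp add: matrix_inv_eqI)
  then show lim: "((\<lambda>lam. lam *\<^sub>R matrix_inv (pen_mat \<Xi> \<alpha> lam (P lam))) \<longlongrightarrow> mat 1) at_top"
    using inv_eq by (rule Lim_transform_eventually)
  have "((\<lambda>lam::real. 1 / lam) \<longlongrightarrow> 0) at_top"
    by (intro tendsto_divide_0[OF tendsto_const] filterlim_at_top_imp_at_infinity filterlim_ident)
  then have "((\<lambda>lam. (1 / lam) *\<^sub>R (lam *\<^sub>R matrix_inv (pen_mat \<Xi> \<alpha> lam (P lam))))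
      \<longlongrightarrow> 0 *\<^sub>R mat 1) at_top"
    by (intro tendsto_intros lim)
  then have "((\<lambda>lam. (1 / lam) *\<^sub>R (lam *\<^sub>R matrix_inv (pen_mat \<Xi> \<alpha> lam (P lam)))) \<longlongrightarrow> 0) at_top"
    by simp
  then show "((\<lambda>lam. matrix_inv (pen_mat \<Xi> \<alpha> lam (P lam))) \<longlongrightarrow> 0) at_top"
    by (rule Lim_transform_eventually)
      (use eventually_gt_at_top[of 0] in eventually_elim, simp)
qed

lemma tendsto_penalty_map_at_top:
  assumes "(P \<longlongrightarrow> L) at_top"
  shows "((\<lambda>lam. penalty_map \<Xi> \<alpha> lam (P lam)) \<longlongrightarrow> L) at_top"
proof -
  have "((\<lambda>lam. penalty_map \<Xi> \<alpha> lam (P lam)) \<longlongrightarrow> L + \<alpha> *\<^sub>R (L ** \<Xi> ** 0 ** transpose \<Xi> ** L)) at_top"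
    unfolding penalty_map_def by (intro tendsto_intros assms tendsto_matrix_inv_pen_mat(2)[OF assms])
  then show ?thesis
    by simp
qed

text \<open>\<open>X\<close> is a supersolution at \<open>lam'\<close>, so some solution
  \<open>Z\<close> at \<open>lam'\<close> lies below it, and \<open>Y\<close> lies below
  \<open>Z\<close>. Minimality is invoked only at the larger penalty.\<close>

lemma least_pen_riccati_solution_antimono:
  assumes Q: "pos_semidef Q" and R: "pos_def R" and \<alpha>: "0 < \<alpha>" and "lam \<le> lam'"
    and X: "pen_riccati_solution A B \<Xi> Q R \<alpha> lam X"
    and Y: "least_pen_riccati_solution A B \<Xi> Q R \<alpha> lam' Y"
  shows "pos_semidef (X - Y)"
proof -
  have X': "pos_semidef X" "pos_def (pen_mat \<Xi> \<alpha> lam X)"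
    "X = dare_map A B Q R \<alpha> (penalty_map \<Xi> \<alpha> lam X)"
    using X unfolding pen_riccati_solution_iff by auto
  note XX = pos_semidef_refl[of X]
  note pen = pos_def_pen_mat_mono[OF X'(2,1,1) XX \<alpha> \<open>lam \<le> lam'\<close>]
  have "pos_semidef (dare_map A B Q R \<alpha> (penalty_map \<Xi> \<alpha> lam X)
      - dare_map A B Q R \<alpha> (penalty_map \<Xi> \<alpha> lam' X))"
    by (intro dare_map_mono penalty_map_mono pos_semidef_penalty_map Q R \<alpha> X'(1,2) XX pen
        \<open>lam \<le> lam'\<close>)
  then have "pos_semidef (X - dare_map A B Q R \<alpha> (penalty_map \<Xi> \<alpha> lam' X))"
    using X'(3) by simp
  from ex_pen_riccati_solution_below[OF Q R \<alpha> X'(1) pen this]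
  obtain Z where Z: "pen_riccati_solution A B \<Xi> Q R \<alpha> lam' Z" "pos_semidef (X - Z)"
    by blast
  then have "pos_semidef (Z - Y)"
    using Y by (simp add: least_pen_riccati_solution_def)
  then show ?thesis
    using Z(2) pos_semidef_trans by blast
qed

theorem proposition7:
  fixes A Q :: "real^'n^'n" and B :: "real^'m^'n" and \<Xi> :: "real^'l^'n"
    and R :: "real^'m^'m" and C :: "real^'n^'p"
    and \<alpha> lam0 :: real and N :: nat and w :: "nat \<Rightarrow> real^'l"
    and P :: "real \<Rightarrow> real^'n^'n"
  assumes "pos_semidef Q" and "pos_def R"
    and "0 < \<alpha>" and "\<alpha> < 1"
    and "1 \<le> N" and "(1 / real N) *\<^sub>R (\<Sum>i=1..N. w i) = 0"
    and "\<And>lam. lam0 \<le> lam \<Longrightarrow> least_pen_riccati_solution A B \<Xi> Q R \<alpha> lam (P lam)"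
    and "stabilizable A B"
    and "Q = transpose C ** C" and "observable A C"
  shows "(\<exists>!Pb. pos_def Pb \<and> dare_solution A B Q R \<alpha> Pb) \<and>
    (\<forall>Pb. pos_def Pb \<and> dare_solution A B Q R \<alpha> Pb \<longrightarrow>
      (\<forall>x.
        ((\<lambda>lam. pen_policy A B \<Xi> R \<alpha> lam (P lam) x) \<longlongrightarrow> dare_gain A B R \<alpha> Pb *v x) at_top \<and>
        (\<forall>i\<in>{1..N}.
          ((\<lambda>lam. worst_case_point A B \<Xi> R \<alpha> lam (P lam) x (w i)) \<longlongrightarrow> w i) at_top)))"
proof -
  have sol: "pen_riccati_solution A B \<Xi> Q R \<alpha> lam (P lam)" if "lam0 \<le> lam" for lam
    using assms(7)[OF that] by (simp add: least_pen_riccati_solution_def)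
  then have psd: "pos_semidef (P lam)" if "lam0 \<le> lam" for lam
    using that by (simp add: pen_riccati_solution_iff)
  \<comment> \<open>The sign change turns the decreasing family into an increasing one bounded above
    by 0.\<close>
  have "\<exists>L. ((\<lambda>lam. - P lam) \<longlongrightarrow> L) at_top"
  proof (rule loewner_mono_tendsto[where m = lam0 and Y = 0])
    show "pos_semidef (- P j - - P i)" if "lam0 \<le> i" "i \<le> j" for i j
      using least_pen_riccati_solution_antimono[OF assms(1-3) that(2) sol[OF that(1)] assms(7)] that
      by simp
  qed (use psd in \<open>auto simp: pos_semidef_def transpose_def vec_eq_iff\<close>)
  then obtain L where "((\<lambda>lam. - P lam) \<longlongrightarrow> - L) at_top"
    by (metis minus_minus)
  then have L: "(P \<longlongrightarrow> L) at_top"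
    by (simp add: tendsto_minus_cancel_left)
  have L_psd: "pos_semidef L"
    by (rule pos_semidef_tendsto[OF L eventually_at_top_linorderI[OF psd] trivial_limit_at_top_linorder])
  note pen_lim = tendsto_penalty_map_at_top[OF L, of \<Xi> \<alpha>]
  \<comment> \<open>For large penalties \<open>P lam\<close> is the Riccati map at
    \<open>penalty_map\<close>, whose argument also tends to \<open>L\<close>. Comparing the two
    limits of \<open>P\<close> gives the fixed point equation.\<close>
  have "(P \<longlongrightarrow> dare_map A B Q R \<alpha> L) at_top"
    using tendsto_dare_map[OF assms(2,3) L_psd pen_lim]
    by (rule Lim_transform_eventually)
      (use eventually_ge_at_top[of lam0] in eventually_elim, metis sol pen_riccati_solution_iff)
  then have L_sol: "dare_solution A B Q R \<alpha> L"
    unfolding dare_solution_iff by (rule tendsto_unique[OF trivial_limit_at_top_linorder L])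
  then have L_def: "pos_def L"
    using pos_def_dare_solution assms(2,3,9,10) L_psd by blast
  \<comment> \<open>Each of the two positive definite solutions dominates the other.\<close>
  have unique: "Pb = L" if Pb: "pos_def Pb" "dare_solution A B Q R \<alpha> Pb" for Pb
  proof (rule pos_semidef_antisym)
    note le = dare_solution_le[OF assms(2,3,10), folded assms(9)]
    show "pos_semidef (Pb - L)"
      by (rule le[OF Pb L_psd L_sol])
    show "pos_semidef (L - Pb)"
      by (rule le[OF L_def L_sol pos_def_imp_semidef[OF Pb(1)] Pb(2)])
  qed (use Pb(1) L_def in \<open>simp_all add: pos_def_transpose\<close>)
  have "((\<lambda>lam. dare_gain A B R \<alpha> (penalty_map \<Xi> \<alpha> lam (P lam))) \<longlongrightarrow> dare_gain A B R \<alpha> L) at_top"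
    by (rule tendsto_dare_gain[OF assms(2,3) L_psd pen_lim])
  then have gain: "((\<lambda>lam. pen_gain A B \<Xi> R \<alpha> lam (P lam)) \<longlongrightarrow> dare_gain A B R \<alpha> L) at_top"
    by (rule Lim_transform_eventually)
      (use eventually_ge_at_top[of lam0] in eventually_elim, simp add: pen_gain_eq psd)
  have policy: "((\<lambda>lam. pen_policy A B \<Xi> R \<alpha> lam (P lam) x) \<longlongrightarrow> dare_gain A B R \<alpha> L *v x) at_top" for x
    unfolding pen_policy_def by (intro tendsto_intros gain)
  have point: "((\<lambda>lam. worst_case_point A B \<Xi> R \<alpha> lam (P lam) x v) \<longlongrightarrow> v) at_top" for x v
  proof -
    \<comment> \<open>The factor \<open>lam\<close> is moved from the sample onto the inverse: the
      state term is an inverse tending to 0 applied to a convergent vector, and the sample term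
      tends to the identity applied to \<open>v\<close>.\<close>
    have "((\<lambda>lam. matrix_inv (pen_mat \<Xi> \<alpha> lam (P lam)) *v
          (\<alpha> *\<^sub>R ((transpose \<Xi> ** P lam ** (A + B ** pen_gain A B \<Xi> R \<alpha> lam (P lam))) *v x))
          + (lam *\<^sub>R matrix_inv (pen_mat \<Xi> \<alpha> lam (P lam))) *v v)
        \<longlongrightarrow> 0 *v (\<alpha> *\<^sub>R ((transpose \<Xi> ** L ** (A + B ** dare_gain A B R \<alpha> L)) *v x)) + mat 1 *v v) at_top"
      by (intro tendsto_intros tendsto_matrix_inv_pen_mat[OF L] L gain)
    then show ?thesis
      by (simp add: worst_case_point_def matrix_vector_right_distrib matrix_vector_mult_scaleR
          scaleR_matrix_vector_assoc)
  qed
  show ?thesis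
    using L_def L_sol unique policy point by blast
qed

end
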